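(* Let $R$ be a commutative ring. The K\"ahler differentials arise as a functor $$\Omega_{(-)/R}:\mathbf{CAlg}_R\to\mathcal{Mod}$$ given on objects by $A\mapsto(A,\Omega_{A/R})$ and on morphisms $f:A\to B$ of commutative $R$-algebras by $$\Omega_{(-)/R}(f):=(f,\mathrm{d}f):(A,\Omega_{A/R})\to(B,\Omega_{B/R}).$$
   Context: $\mathbf{CAlg}_R$ is the category of commutative $R$-algebras. $\mathcal{Mod}$ is the total category of the fibration of modules over commutative rings: objects are pairs $(R,M)$ with $R$ a commutative ring and $M$ an $R$-module; a morphism $(R,M)\to(S,N)$ is a pair $(f,\rho)$ with $f:R\to S$ a ring map and $\rho:M\to\mathrm{res}_f(N)$ an $R$-linear map, where $\mathrm{res}_f$ is restriction of scalars; composition is $(g,\varphi)\circ(f,\rho)=(g\circ f,\mathrm{res}_f(\varphi)\circ\rho)$; identities are $(\mathrm{id}_R,\mathrm{id}_M)$. $\Omega_{A/R}$ is the $A$-module of relative K\"ahler differentials. For $f:A\to B$ in $\mathbf{CAlg}_R$, $\mathrm{d}f:\Omega_{A/R}\to\mathrm{res}_f(\Omega_{B/R})$ is the $A$-linear map determined by $\mathrm{d}a\mapsto\mathrm{d}(f(a))$. *)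

theory Defs
  imports "HOL-Algebra.Module" "HOL-Algebra.AbelCoset"
begin

section \<open>Categories and functors\<close>

text \<open>Categories are given by hom-sets indexed by source and target; the hom-sets need not be
  disjoint, so composition and the arrow part of a functor take the objects as arguments.
  \<open>Comp C X Y Z g f\<close> is the composite of \<open>f\<close> from \<open>X\<close> to \<open>Y\<close> with \<open>g\<close> from \<open>Y\<close> to \<open>Z\<close>.\<close>

record ('o, 'm) category =
  Ob :: "'o set"
  Hom :: "'o \<Rightarrow> 'o \<Rightarrow> 'm set"
  Comp :: "'o \<Rightarrow> 'o \<Rightarrow> 'o \<Rightarrow> 'm \<Rightarrow> 'm \<Rightarrow> 'm"
  Id :: "'o \<Rightarrow> 'm"

locale category =
  fixes C :: "('o, 'm) category"
  assumes Id_in_Hom: "X \<in> Ob C \<Longrightarrow> Id C X \<in> Hom C X X"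
    and Comp_in_Hom:
      "\<lbrakk>X \<in> Ob C; Y \<in> Ob C; Z \<in> Ob C; f \<in> Hom C X Y; g \<in> Hom C Y Z\<rbrakk>
        \<Longrightarrow> Comp C X Y Z g f \<in> Hom C X Z"
    and Comp_Id_left:
      "\<lbrakk>X \<in> Ob C; Y \<in> Ob C; f \<in> Hom C X Y\<rbrakk> \<Longrightarrow> Comp C X Y Y (Id C Y) f = f"
    and Comp_Id_right:
      "\<lbrakk>X \<in> Ob C; Y \<in> Ob C; f \<in> Hom C X Y\<rbrakk> \<Longrightarrow> Comp C X X Y f (Id C X) = f"
    and Comp_assoc:
      "\<lbrakk>W \<in> Ob C; X \<in> Ob C; Y \<in> Ob C; Z \<in> Ob C;
        f \<in> Hom C W X; g \<in> Hom C X Y; h \<in> Hom C Y Z\<rbrakk>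
        \<Longrightarrow> Comp C W Y Z h (Comp C W X Y g f) = Comp C W X Z (Comp C X Y Z h g) f"

locale cat_functor = C: category C + D: category D
  for C :: "('o, 'm) category" and D :: "('p, 'n) category" +
  fixes F_ob :: "'o \<Rightarrow> 'p" and F_hom :: "'o \<Rightarrow> 'o \<Rightarrow> 'm \<Rightarrow> 'n"
  assumes F_ob: "X \<in> Ob C \<Longrightarrow> F_ob X \<in> Ob D"
    and F_hom:
      "\<lbrakk>X \<in> Ob C; Y \<in> Ob C; f \<in> Hom C X Y\<rbrakk> \<Longrightarrow> F_hom X Y f \<in> Hom D (F_ob X) (F_ob Y)"
    and F_Id: "X \<in> Ob C \<Longrightarrow> F_hom X X (Id C X) = Id D (F_ob X)"
    and F_Comp:
      "\<lbrakk>X \<in> Ob C; Y \<in> Ob C; Z \<in> Ob C; f \<in> Hom C X Y; g \<in> Hom C Y Z\<rbrakk>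
        \<Longrightarrow> F_hom X Z (Comp C X Y Z g f) =
          Comp D (F_ob X) (F_ob Y) (F_ob Z) (F_hom Y Z g) (F_hom X Y f)"


section \<open>Constructions on modules\<close>

text \<open>All maps are required to be extensional on the carrier of their source, so that two
  homomorphisms are equal as soon as they agree there. The \<open>mult\<close> and \<open>one\<close> fields of a module
  record carry no meaning for modules.\<close>

definition linear_maps ::
    "('r, 'x) ring_scheme \<Rightarrow> ('r, 'm, 'y) module_scheme \<Rightarrow> ('r, 'n, 'z) module_scheme
      \<Rightarrow> ('m \<Rightarrow> 'n) set" where
  "linear_maps R M N =
    {h \<in> carrier M \<rightarrow>\<^sub>E carrier N.
      (\<forall>x \<in> carrier M. \<forall>y \<in> carrier M. h (x \<oplus>\<^bsub>M\<^esub> y) = h x \<oplus>\<^bsub>N\<^esub> h y) \<and>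
      (\<forall>r \<in> carrier R. \<forall>x \<in> carrier M. h (r \<odot>\<^bsub>M\<^esub> x) = r \<odot>\<^bsub>N\<^esub> h x)}"

definition res_scalars :: "('r \<Rightarrow> 's) \<Rightarrow> ('s, 'n) module \<Rightarrow> ('r, 'n) module" where
  "res_scalars f N =
    \<lparr>carrier = carrier N, mult = mult N, one = one N, zero = zero N, add = add N,
     smult = (\<lambda>r x. f r \<odot>\<^bsub>N\<^esub> x)\<rparr>"

definition free_module :: "('r, 'x) ring_scheme \<Rightarrow> 'i set \<Rightarrow> ('r, 'i \<Rightarrow> 'r) module" where
  "free_module R I =
    \<lparr>carrier = {u \<in> I \<rightarrow>\<^sub>E carrier R. finite {i \<in> I. u i \<noteq> \<zero>\<^bsub>R\<^esub>}},
     mult = undefined, one = undefined,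
     zero = (\<lambda>i\<in>I. \<zero>\<^bsub>R\<^esub>),
     add = (\<lambda>u v. \<lambda>i\<in>I. u i \<oplus>\<^bsub>R\<^esub> v i),
     smult = (\<lambda>r u. \<lambda>i\<in>I. r \<otimes>\<^bsub>R\<^esub> u i)\<rparr>"

definition free_gen :: "('r, 'x) ring_scheme \<Rightarrow> 'i set \<Rightarrow> 'i \<Rightarrow> 'i \<Rightarrow> 'r" where
  "free_gen R I i = (\<lambda>j\<in>I. if j = i then \<one>\<^bsub>R\<^esub> else \<zero>\<^bsub>R\<^esub>)"

definition submodule_span ::
    "('r, 'x) ring_scheme \<Rightarrow> ('r, 'm, 'y) module_scheme \<Rightarrow> 'm set \<Rightarrow> 'm set" where
  "submodule_span R M S = \<Inter> {N. submodule N R M \<and> S \<subseteq> N}"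

definition quot_module :: "('r, 'm, 'y) module_scheme \<Rightarrow> 'm set \<Rightarrow> ('r, 'm set) module" where
  "quot_module M N =
    \<lparr>carrier = a_rcosets\<^bsub>M\<^esub> N, mult = undefined, one = undefined,
     zero = N, add = set_add M,
     smult = (\<lambda>r X. \<Union>x\<in>X. N +>\<^bsub>M\<^esub> (r \<odot>\<^bsub>M\<^esub> x))\<rparr>"


section \<open>Kaehler differentials\<close>

text \<open>\<open>kaehler R A\<close> is the free \<open>A\<close>-module on symbols \<open>\<delta> a\<close>, one for each \<open>a\<close> in \<open>A\<close>, modulo
  additivity, the Leibniz rule, and the vanishing of \<open>\<delta>\<close> on the image of \<open>R\<close> in \<open>A\<close>.\<close>

definition kaehler_rels ::
    "('r, 'x) ring_scheme \<Rightarrow> ('r, 'a) module \<Rightarrow> ('a \<Rightarrow> 'a) set" where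
  "kaehler_rels R A =
    (let F = free_module A (carrier A); \<delta> = free_gen A (carrier A) in
      {\<delta> (a \<oplus>\<^bsub>A\<^esub> b) \<ominus>\<^bsub>F\<^esub> (\<delta> a \<oplus>\<^bsub>F\<^esub> \<delta> b) | a b. a \<in> carrier A \<and> b \<in> carrier A} \<union>
      {\<delta> (a \<otimes>\<^bsub>A\<^esub> b) \<ominus>\<^bsub>F\<^esub> (a \<odot>\<^bsub>F\<^esub> \<delta> b \<oplus>\<^bsub>F\<^esub> b \<odot>\<^bsub>F\<^esub> \<delta> a) | a b. a \<in> carrier A \<and> b \<in> carrier A} \<union>
      {\<delta> (r \<odot>\<^bsub>A\<^esub> \<one>\<^bsub>A\<^esub>) | r. r \<in> carrier R})"

definition kaehler_submodule ::
    "('r, 'x) ring_scheme \<Rightarrow> ('r, 'a) module \<Rightarrow> ('a \<Rightarrow> 'a) set" where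
  "kaehler_submodule R A = submodule_span A (free_module A (carrier A)) (kaehler_rels R A)"

definition kaehler ::
    "('r, 'x) ring_scheme \<Rightarrow> ('r, 'a) module \<Rightarrow> ('a, ('a \<Rightarrow> 'a) set) module" where
  "kaehler R A = quot_module (free_module A (carrier A)) (kaehler_submodule R A)"

definition univ_deriv ::
    "('r, 'x) ring_scheme \<Rightarrow> ('r, 'a) module \<Rightarrow> 'a \<Rightarrow> ('a \<Rightarrow> 'a) set" where
  "univ_deriv R A a =
    kaehler_submodule R A +>\<^bsub>free_module A (carrier A)\<^esub> free_gen A (carrier A) a"

definition is_kaehler_map ::
    "('r, 'x) ring_scheme \<Rightarrow> ('r, 'a) module \<Rightarrow> ('r, 'b) module \<Rightarrow> ('a \<Rightarrow> 'b)
      \<Rightarrow> (('a \<Rightarrow> 'a) set \<Rightarrow> ('b \<Rightarrow> 'b) set) \<Rightarrow> bool" where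
  "is_kaehler_map R A B f \<rho> \<longleftrightarrow>
    \<rho> \<in> linear_maps A (kaehler R A) (res_scalars f (kaehler R B)) \<and>
    (\<forall>a \<in> carrier A. \<rho> (univ_deriv R A a) = univ_deriv R B (f a))"

definition kaehler_map ::
    "('r, 'x) ring_scheme \<Rightarrow> ('r, 'a) module \<Rightarrow> ('r, 'b) module \<Rightarrow> ('a \<Rightarrow> 'b)
      \<Rightarrow> ('a \<Rightarrow> 'a) set \<Rightarrow> ('b \<Rightarrow> 'b) set" where
  "kaehler_map R A B f = (THE \<rho>. is_kaehler_map R A B f \<rho>)"


section \<open>The two categories\<close>

text \<open>As HOL has no type of all sets, each category consists of the structures whose carriers are
  subsets of given types. These type variables are arbitrary and play the role of universes.\<close>

definition CAlg :: "('r, 'x) ring_scheme \<Rightarrow> (('r, 'a) module, 'a \<Rightarrow> 'a) category" where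
  "CAlg R =
    \<lparr>Ob = {A. algebra R A},
     Hom = (\<lambda>A B. ring_hom A B \<inter> linear_maps R A B),
     Comp = (\<lambda>A B C g f. compose (carrier A) g f),
     Id = (\<lambda>A. \<lambda>x\<in>carrier A. x)\<rparr>"

text \<open>Restriction of scalars does not change the underlying function of a linear map, so the
  second component of a composite is composition of functions.\<close>

definition ModCat ::
    "('a ring \<times> ('a, 'm) module, ('a \<Rightarrow> 'a) \<times> ('m \<Rightarrow> 'm)) category" where
  "ModCat =
    \<lparr>Ob = {(R, M). cring R \<and> module R M},
     Hom = (\<lambda>(R, M) (S, N). {(f, \<rho>). f \<in> ring_hom R S \<and> f \<in> extensional (carrier R) \<and>
       \<rho> \<in> linear_maps R M (res_scalars f N)}),
     Comp = (\<lambda>(R, M) (S, N) (T, P) (g, \<phi>) (f, \<rho>).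
       (compose (carrier R) g f, compose (carrier M) \<phi> \<rho>)),
     Id = (\<lambda>(R, M). (\<lambda>x\<in>carrier R. x, \<lambda>x\<in>carrier M. x))\<rparr>"

end

theory Submission
  imports Defs
begin

text \<open>The module of differentials of an algebra \<open>A\<close> is built so that \<open>univ_deriv R A\<close> is the universal
  \<open>R\<close>-derivation out of \<open>A\<close>: every derivation into an \<open>A\<close>-module is the composite of \<open>univ_deriv R A\<close>
  with a linear map (lemma \<open>kaehler_lift\<close>), and a linear map out of the differentials is determined
  by its values on the elements \<open>univ_deriv R A a\<close> (lemma \<open>kaehler_hom_eqI\<close>). Both come from the
  universal properties of free modules and of quotients.

  An algebra map \<open>f\<close> from \<open>A\<close> to \<open>B\<close> turns the universal derivation of \<open>B\<close> into a derivation of \<open>A\<close>,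
  with values in the differentials of \<open>B\<close> seen as an \<open>A\<close>-module through \<open>f\<close>. Hence there is exactly
  one map of differentials over \<open>f\<close> (lemma \<open>is_kaehler_map_ex1\<close>). Functoriality needs no further
  computation: the identity map and composites of maps of differentials have the defining
  property (lemmas \<open>is_kaehler_map_id\<close> and \<open>is_kaehler_map_compose\<close>), and uniqueness does the rest.
  What remains is that the two categories are categories, where the composition in the category
  of modules is composition of functions because restriction of scalars leaves functions unchanged.\<close>

section \<open>Linear maps and submodules\<close>

lemma linear_mapsI:
  assumes "h \<in> carrier M \<rightarrow>\<^sub>E carrier N"
    and "\<And>x y. \<lbrakk>x \<in> carrier M; y \<in> carrier M\<rbrakk> \<Longrightarrow> h (x \<oplus>\<^bsub>M\<^esub> y) = h x \<oplus>\<^bsub>N\<^esub> h y"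
    and "\<And>r x. \<lbrakk>r \<in> carrier R; x \<in> carrier M\<rbrakk> \<Longrightarrow> h (r \<odot>\<^bsub>M\<^esub> x) = r \<odot>\<^bsub>N\<^esub> h x"
  shows "h \<in> linear_maps R M N"
  using assms unfolding linear_maps_def by blast

lemma linear_mapsD:
  assumes "h \<in> linear_maps R M N"
  shows "h \<in> carrier M \<rightarrow>\<^sub>E carrier N"
    and "\<And>x. x \<in> carrier M \<Longrightarrow> h x \<in> carrier N"
    and "\<And>x y. \<lbrakk>x \<in> carrier M; y \<in> carrier M\<rbrakk> \<Longrightarrow> h (x \<oplus>\<^bsub>M\<^esub> y) = h x \<oplus>\<^bsub>N\<^esub> h y"
    and "\<And>r x. \<lbrakk>r \<in> carrier R; x \<in> carrier M\<rbrakk> \<Longrightarrow> h (r \<odot>\<^bsub>M\<^esub> x) = r \<odot>\<^bsub>N\<^esub> h x"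
  using assms unfolding linear_maps_def by auto

lemma linear_map_zero:
  assumes "module R M" "module R N" "h \<in> linear_maps R M N"
  shows "h \<zero>\<^bsub>M\<^esub> = \<zero>\<^bsub>N\<^esub>"
proof -
  interpret M: module R M by fact
  interpret N: module R N by fact
  have "h (\<zero>\<^bsub>R\<^esub> \<odot>\<^bsub>M\<^esub> \<zero>\<^bsub>M\<^esub>) = \<zero>\<^bsub>R\<^esub> \<odot>\<^bsub>N\<^esub> h \<zero>\<^bsub>M\<^esub>"
    by (rule linear_mapsD(4)[OF assms(3)]) auto
  then show ?thesis using linear_mapsD(2)[OF assms(3)] by simp
qed

lemma linear_map_uminus:
  assumes "module R M" "module R N" "h \<in> linear_maps R M N" "x \<in> carrier M"
  shows "h (\<ominus>\<^bsub>M\<^esub> x) = \<ominus>\<^bsub>N\<^esub> h x"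
proof -
  interpret M: module R M by fact
  interpret N: module R N by fact
  have "h ((\<ominus>\<^bsub>R\<^esub> \<one>\<^bsub>R\<^esub>) \<odot>\<^bsub>M\<^esub> x) = (\<ominus>\<^bsub>R\<^esub> \<one>\<^bsub>R\<^esub>) \<odot>\<^bsub>N\<^esub> h x"
    using linear_mapsD(4)[OF assms(3)] assms(4) by simp
  then show ?thesis
    using linear_mapsD(2)[OF assms(3)] assms(4) by (simp add: M.smult_l_minus N.smult_l_minus)
qed

lemma linear_map_minus:
  assumes "module R M" "module R N" "h \<in> linear_maps R M N" "x \<in> carrier M" "y \<in> carrier M"
  shows "h (x \<ominus>\<^bsub>M\<^esub> y) = h x \<ominus>\<^bsub>N\<^esub> h y"
proof -
  interpret M: module R M by fact
  show ?thesis using assms linear_mapsD(3)[OF assms(3)] linear_map_uminus[OF assms(1-3)]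
    by (simp add: a_minus_def)
qed

lemma linear_map_compose:
  assumes "h \<in> linear_maps R M N" "k \<in> linear_maps R N P"
    and "\<And>x y. \<lbrakk>x \<in> carrier M; y \<in> carrier M\<rbrakk> \<Longrightarrow> x \<oplus>\<^bsub>M\<^esub> y \<in> carrier M"
    and "\<And>r x. \<lbrakk>r \<in> carrier R; x \<in> carrier M\<rbrakk> \<Longrightarrow> r \<odot>\<^bsub>M\<^esub> x \<in> carrier M"
  shows "compose (carrier M) k h \<in> linear_maps R M P"
  using assms linear_mapsD(2-4)[OF assms(1)] linear_mapsD(2-4)[OF assms(2)]
  by (intro linear_mapsI) (auto simp: compose_def)

lemma linear_map_ext:
  assumes "h \<in> linear_maps R M N" "k \<in> linear_maps R M P"
    and "\<And>x. x \<in> carrier M \<Longrightarrow> h x = k x"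
  shows "h = k"
  using linear_mapsD(1)[OF assms(1)] linear_mapsD(1)[OF assms(2)] assms(3)
  by (intro extensionalityI[of _ "carrier M"]) (auto simp: PiE_def)

text \<open>Two linear maps that agree on a set agree on the submodule it spans. This is how uniqueness of a
  linear map is reduced to its values on generators, and how a map is seen to kill a submodule given
  by relations.\<close>

lemma submodule_equalizer:
  assumes "module R M" "module R N" "h \<in> linear_maps R M N" "k \<in> linear_maps R M N"
  shows "submodule {x \<in> carrier M. h x = k x} R M"
proof -
  interpret M: module R M by fact
  note zero = linear_map_zero[OF assms(1,2)] and um = linear_map_uminus[OF assms(1,2)]
  show ?thesis
    using zero[OF assms(3)] zero[OF assms(4)] um[OF assms(3)] um[OF assms(4)]
      linear_mapsD[OF assms(3)] linear_mapsD[OF assms(4)]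
    by (intro M.submoduleI) auto
qed

lemma submodule_kernel:
  assumes "module R M" "module R N" "h \<in> linear_maps R M N"
  shows "submodule {x \<in> carrier M. h x = \<zero>\<^bsub>N\<^esub>} R M"
proof -
  interpret M: module R M by fact
  interpret N: module R N by fact
  let ?z = "\<lambda>x\<in>carrier M. \<zero>\<^bsub>N\<^esub>"
  have "?z \<in> linear_maps R M N" by (rule linear_mapsI) auto
  from submodule_equalizer[OF assms this]
  show ?thesis by (rule back_subst[of "\<lambda>S. submodule S R M"]) auto
qed

lemma submodule_span_least:
  assumes "submodule N R M" "S \<subseteq> N"
  shows "submodule_span R M S \<subseteq> N"
  using assms unfolding submodule_span_def by blast

lemma submodule_span_superset: "S \<subseteq> submodule_span R M S"
  unfolding submodule_span_def by blast

lemma submodule_submodule_span: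
  assumes "module R M" "S \<subseteq> carrier M"
  shows "submodule (submodule_span R M S) R M"
proof -
  interpret M: module R M by fact
  have carrier: "submodule (carrier M) R M" by (rule M.carrier_is_submodule)
  have zero: "\<zero>\<^bsub>M\<^esub> \<in> N" if "submodule N R M" for N
    using subgroup.one_closed[OF submodule.axioms(1)[OF that]] by simp
  show ?thesis
    unfolding submodule_span_def
  proof (intro M.submoduleI)
    show "\<Inter> {N. submodule N R M \<and> S \<subseteq> N} \<subseteq> carrier M" using carrier assms(2) by blast
  qed (auto simp: zero M.submoduleE)
qed

text \<open>Restriction of scalars supplies the target module in the statement that the map of differentials
  induced by \<open>f\<close> is linear over the source ring of \<open>f\<close>.\<close>

lemma module_res_scalars:
  assumes "cring A" "module B N" "f \<in> ring_hom A B"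
  shows "module A (res_scalars f N)"
proof -
  interpret N: module B N by fact
  have "abelian_group (res_scalars f N)"
    using N.l_neg by (intro abelian_groupI) (auto simp: res_scalars_def N.a_ac intro: bexI[OF _ N.a_inv_closed])
  with assms(1) show ?thesis
    using ring_hom_closed[OF assms(3)] ring_hom_one[OF assms(3)]
    by (intro moduleI)
      (auto simp: res_scalars_def N.smult_l_distr N.smult_r_distr N.smult_assoc1
        ring_hom_add[OF assms(3)] ring_hom_mult[OF assms(3)])
qed

section \<open>Quotient modules\<close>

lemma submodule_abelian_subgroup:
  assumes "module R M" "submodule N R M"
  shows "abelian_subgroup N M"
proof -
  interpret M: module R M by fact
  show ?thesis
    by (intro abelian_subgroupI3 additive_subgroupI submodule.axioms(1)[OF assms(2)]
        M.abelian_group_axioms)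
qed

lemma coset_eq_iff:
  assumes "module R M" "submodule N R M" "x \<in> carrier M" "y \<in> carrier M"
  shows "N +>\<^bsub>M\<^esub> x = N +>\<^bsub>M\<^esub> y \<longleftrightarrow> x \<ominus>\<^bsub>M\<^esub> y \<in> N"
proof -
  interpret N: abelian_subgroup N M by (rule submodule_abelian_subgroup[OF assms(1,2)])
  show ?thesis
    using N.a_rcos_module[OF assms(4,3)] N.a_repr_independence' N.a_repr_independenceD N.a_rcos_self assms(3,4)
    by (metis a_minus_def N.a_subset N.a_repr_independence')
qed

lemma quot_module_carrier: "carrier (quot_module M N) = (\<lambda>x. N +>\<^bsub>M\<^esub> x) ` carrier M"
  by (auto simp: quot_module_def A_RCOSETS_def')

lemma quot_module_add:
  assumes "module R M" "submodule N R M" "x \<in> carrier M" "y \<in> carrier M"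
  shows "(N +>\<^bsub>M\<^esub> x) \<oplus>\<^bsub>quot_module M N\<^esub> (N +>\<^bsub>M\<^esub> y) = N +>\<^bsub>M\<^esub> (x \<oplus>\<^bsub>M\<^esub> y)"
  using abelian_subgroup.a_rcos_sum[OF submodule_abelian_subgroup[OF assms(1,2)] assms(3,4)]
  by (simp add: quot_module_def)

lemma quot_module_zero:
  assumes "module R M" "submodule N R M"
  shows "\<zero>\<^bsub>quot_module M N\<^esub> = N +>\<^bsub>M\<^esub> \<zero>\<^bsub>M\<^esub>"
proof -
  interpret N: abelian_subgroup N M by (rule submodule_abelian_subgroup[OF assms])
  show ?thesis by (simp add: quot_module_def N.a_subset)
qed

text \<open>The scalar multiple of a coset is defined as a union over all its representatives. Multiples of
  two representatives differ by a multiple of an element of the submodule, so the cosets in this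
  union are all the same one.\<close>

lemma quot_module_smult:
  assumes "module R M" "submodule N R M" "r \<in> carrier R" "x \<in> carrier M"
  shows "r \<odot>\<^bsub>quot_module M N\<^esub> (N +>\<^bsub>M\<^esub> x) = N +>\<^bsub>M\<^esub> (r \<odot>\<^bsub>M\<^esub> x)"
proof -
  interpret M: module R M by fact
  interpret N: abelian_subgroup N M by (rule submodule_abelian_subgroup[OF assms(1,2)])
  have "N +>\<^bsub>M\<^esub> (r \<odot>\<^bsub>M\<^esub> y) = N +>\<^bsub>M\<^esub> (r \<odot>\<^bsub>M\<^esub> x)" if y: "y \<in> N +>\<^bsub>M\<^esub> x" for y
  proof -
    have yc: "y \<in> carrier M" using y N.a_elemrcos_carrier assms(4) by blast
    have "y \<ominus>\<^bsub>M\<^esub> x \<in> N"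
      using coset_eq_iff[OF assms(1,2) yc assms(4)] N.a_repr_independence'[OF y assms(4)] by simp
    then have "r \<odot>\<^bsub>M\<^esub> (y \<ominus>\<^bsub>M\<^esub> x) \<in> N"
      using M.submoduleE(4)[OF assms(2,3)] by blast
    moreover have "r \<odot>\<^bsub>M\<^esub> (y \<ominus>\<^bsub>M\<^esub> x) = r \<odot>\<^bsub>M\<^esub> y \<ominus>\<^bsub>M\<^esub> r \<odot>\<^bsub>M\<^esub> x"
      using yc assms(3,4) by (simp add: a_minus_def M.smult_r_distr M.smult_r_minus)
    ultimately show ?thesis
      using coset_eq_iff[OF assms(1,2)] yc assms(3,4) by simp
  qed
  then have "(\<Union>y\<in>N +>\<^bsub>M\<^esub> x. N +>\<^bsub>M\<^esub> (r \<odot>\<^bsub>M\<^esub> y)) = (\<Union>y\<in>N +>\<^bsub>M\<^esub> x. N +>\<^bsub>M\<^esub> (r \<odot>\<^bsub>M\<^esub> x))"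
    by (rule SUP_cong[OF refl])
  also have "\<dots> = N +>\<^bsub>M\<^esub> (r \<odot>\<^bsub>M\<^esub> x)"
    using N.a_rcos_self[OF assms(4)] by blast
  finally show ?thesis by (simp add: quot_module_def)
qed

lemma module_quot_module:
  assumes "module R M" "submodule N R M"
  shows "module R (quot_module M N)"
proof -
  interpret M: module R M by fact
  note add = quot_module_add[OF assms] and zero = quot_module_zero[OF assms]
    and smult = quot_module_smult[OF assms]
  have neg: "\<exists>y \<in> carrier (quot_module M N). y \<oplus>\<^bsub>quot_module M N\<^esub> x = \<zero>\<^bsub>quot_module M N\<^esub>"
    if x: "x \<in> carrier (quot_module M N)" for x
  proof -
    obtain m where m: "m \<in> carrier M" "x = N +>\<^bsub>M\<^esub> m" using x by (auto simp: quot_module_carrier)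
    then show ?thesis
      by (intro bexI[of _ "N +>\<^bsub>M\<^esub> (\<ominus>\<^bsub>M\<^esub> m)"]) (auto simp: add zero quot_module_carrier M.l_neg)
  qed
  have "abelian_group (quot_module M N)"
    by (rule abelian_groupI[OF _ _ _ _ _ neg])
      (auto simp: quot_module_carrier add zero M.a_ac)
  then show ?thesis
    by (intro moduleI M.is_cring)
      (auto simp: quot_module_carrier add zero smult M.smult_l_distr M.smult_r_distr M.smult_assoc1)
qed

lemma quot_module_proj_linear:
  assumes "module R M" "submodule N R M"
  shows "(\<lambda>x\<in>carrier M. N +>\<^bsub>M\<^esub> x) \<in> linear_maps R M (quot_module M N)"
proof -
  interpret M: module R M by fact
  show ?thesis
    by (intro linear_mapsI)
      (auto simp: quot_module_carrier quot_module_add[OF assms] quot_module_smult[OF assms])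
qed

text \<open>The universal property of the quotient, in its existence half: the value of \<open>h\<close> at any
  representative depends on the coset only, as representatives differ by elements that \<open>h\<close> kills.\<close>

lemma quot_module_lift:
  assumes "module R M" "submodule N R M" "module R P" "h \<in> linear_maps R M P"
    and vanish: "\<And>x. x \<in> N \<Longrightarrow> h x = \<zero>\<^bsub>P\<^esub>"
  obtains k where "k \<in> linear_maps R (quot_module M N) P"
    and "\<And>x. x \<in> carrier M \<Longrightarrow> k (N +>\<^bsub>M\<^esub> x) = h x"
proof -
  interpret M: module R M by fact
  interpret P: module R P by fact
  note h = linear_mapsD[OF assms(4)]
  let ?rep = "\<lambda>X. SOME x. x \<in> carrier M \<and> X = N +>\<^bsub>M\<^esub> x"
  define k where "k = (\<lambda>X\<in>carrier (quot_module M N). h (?rep X))"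
  have k: "k (N +>\<^bsub>M\<^esub> x) = h x" if x: "x \<in> carrier M" for x
  proof -
    have rep: "?rep (N +>\<^bsub>M\<^esub> x) \<in> carrier M \<and> N +>\<^bsub>M\<^esub> x = N +>\<^bsub>M\<^esub> ?rep (N +>\<^bsub>M\<^esub> x)"
      by (rule someI[of "\<lambda>y. y \<in> carrier M \<and> N +>\<^bsub>M\<^esub> x = N +>\<^bsub>M\<^esub> y" x]) (use x in simp)
    then have "x \<ominus>\<^bsub>M\<^esub> ?rep (N +>\<^bsub>M\<^esub> x) \<in> N"
      using coset_eq_iff[OF assms(1,2) x] by blast
    then have "h x \<ominus>\<^bsub>P\<^esub> h (?rep (N +>\<^bsub>M\<^esub> x)) = \<zero>\<^bsub>P\<^esub>"
      using vanish linear_map_minus[OF assms(1,3,4) x conjunct1[OF rep]] by simp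
    then have "h x = h (?rep (N +>\<^bsub>M\<^esub> x))"
      using h(2)[OF x] h(2)[OF conjunct1[OF rep]]
      by (simp add: a_minus_def P.add.inv_solve_right')
    then show ?thesis using x by (simp add: k_def quot_module_carrier)
  qed
  have "k \<in> linear_maps R (quot_module M N) P"
  proof (rule linear_mapsI)
    show "k \<in> carrier (quot_module M N) \<rightarrow>\<^sub>E carrier P"
    proof (rule PiE_I)
      fix X assume "X \<in> carrier (quot_module M N)"
      then show "k X \<in> carrier P" using k h(2) by (auto simp: quot_module_carrier)
    qed (simp add: k_def)
  qed (auto simp: quot_module_carrier quot_module_add[OF assms(1,2)]
      quot_module_smult[OF assms(1,2)] k h(3,4))
  with k show ?thesis by (rule that[rotated])
qed


section \<open>Free modules\<close>

lemma free_module_simps: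
  "carrier (free_module A I) = {u \<in> I \<rightarrow>\<^sub>E carrier A. finite {i \<in> I. u i \<noteq> \<zero>\<^bsub>A\<^esub>}}"
  "\<zero>\<^bsub>free_module A I\<^esub> = (\<lambda>i\<in>I. \<zero>\<^bsub>A\<^esub>)"
  "u \<oplus>\<^bsub>free_module A I\<^esub> v = (\<lambda>i\<in>I. u i \<oplus>\<^bsub>A\<^esub> v i)"
  "a \<odot>\<^bsub>free_module A I\<^esub> u = (\<lambda>i\<in>I. a \<otimes>\<^bsub>A\<^esub> u i)"
  by (simp_all add: free_module_def)

text \<open>Apart from the finiteness of supports, all module laws hold pointwise because they hold in the
  ring.\<close>

lemma module_free_module:
  assumes "cring A"
  shows "module A (free_module A I)"
proof -
  interpret A: cring A by fact
  let ?F = "free_module A I"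
  \<comment> \<open>A function that vanishes wherever two members vanish has its support in a finite union.\<close>
  have fin: "finite {i \<in> I. w i \<noteq> \<zero>\<^bsub>A\<^esub>}"
    if "u \<in> carrier ?F" "v \<in> carrier ?F"
      and "\<And>i. \<lbrakk>i \<in> I; u i = \<zero>\<^bsub>A\<^esub>; v i = \<zero>\<^bsub>A\<^esub>\<rbrakk> \<Longrightarrow> w i = \<zero>\<^bsub>A\<^esub>" for u v w
    by (rule finite_subset[of _ "{i \<in> I. u i \<noteq> \<zero>\<^bsub>A\<^esub>} \<union> {i \<in> I. v i \<noteq> \<zero>\<^bsub>A\<^esub>}"])
      (use that in \<open>auto simp: free_module_simps\<close>)
  have carr: "u i \<in> carrier A" if "u \<in> carrier ?F" "i \<in> I" for u i
    using that by (auto simp: free_module_simps)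
  have add: "u \<oplus>\<^bsub>?F\<^esub> v \<in> carrier ?F" if "u \<in> carrier ?F" "v \<in> carrier ?F" for u v
  proof -
    have "finite {i \<in> I. (u \<oplus>\<^bsub>?F\<^esub> v) i \<noteq> \<zero>\<^bsub>A\<^esub>}"
      by (rule fin[OF that]) (simp add: free_module_simps)
    then show ?thesis using that by (auto simp: free_module_simps)
  qed
  have smult: "a \<odot>\<^bsub>?F\<^esub> u \<in> carrier ?F" if "a \<in> carrier A" "u \<in> carrier ?F" for a u
  proof -
    have "finite {i \<in> I. (a \<odot>\<^bsub>?F\<^esub> u) i \<noteq> \<zero>\<^bsub>A\<^esub>}"
      by (rule fin[OF that(2,2)]) (simp add: free_module_simps that)
    then show ?thesis using that by (auto simp: free_module_simps)
  qed
  have ext: "u = v" if "u \<in> extensional I" "v \<in> extensional I" "\<And>i. i \<in> I \<Longrightarrow> u i = v i" for u v :: "_ \<Rightarrow> 'a"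
    using that by (rule extensionalityI)
  have in_ext: "u \<in> extensional I" if "u \<in> carrier ?F" for u
    using that by (simp add: free_module_simps PiE_def)
  have neg: "\<exists>v \<in> carrier ?F. v \<oplus>\<^bsub>?F\<^esub> u = \<zero>\<^bsub>?F\<^esub>" if u: "u \<in> carrier ?F" for u
  proof (rule bexI)
    let ?v = "(\<ominus>\<^bsub>A\<^esub> \<one>\<^bsub>A\<^esub>) \<odot>\<^bsub>?F\<^esub> u"
    show "?v \<in> carrier ?F" using u by (intro smult) auto
    show "?v \<oplus>\<^bsub>?F\<^esub> u = \<zero>\<^bsub>?F\<^esub>"
      using carr[OF u] by (auto simp: free_module_simps A.l_minus A.l_neg)
  qed
  have "abelian_group ?F"
  proof (rule abelian_groupI[OF add _ _ _ _ neg])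
    show "\<zero>\<^bsub>?F\<^esub> \<in> carrier ?F" by (auto simp: free_module_simps)
    fix u assume u: "u \<in> carrier ?F"
    show "\<zero>\<^bsub>?F\<^esub> \<oplus>\<^bsub>?F\<^esub> u = u"
      by (rule ext) (use carr[OF u] in_ext[OF u] in \<open>auto simp: free_module_simps\<close>)
    fix v assume v: "v \<in> carrier ?F"
    show "u \<oplus>\<^bsub>?F\<^esub> v = v \<oplus>\<^bsub>?F\<^esub> u"
      using carr[OF u] carr[OF v] by (auto simp: free_module_simps A.a_comm)
    fix w assume w: "w \<in> carrier ?F"
    show "(u \<oplus>\<^bsub>?F\<^esub> v) \<oplus>\<^bsub>?F\<^esub> w = u \<oplus>\<^bsub>?F\<^esub> (v \<oplus>\<^bsub>?F\<^esub> w)"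
      using carr[OF u] carr[OF v] carr[OF w] by (auto simp: free_module_simps A.a_assoc)
  qed
  then show ?thesis
  proof (intro moduleI assms smult)
    fix u assume u: "u \<in> carrier ?F"
    show "\<one>\<^bsub>A\<^esub> \<odot>\<^bsub>?F\<^esub> u = u"
      by (rule ext) (use carr[OF u] in_ext[OF u] in \<open>auto simp: free_module_simps\<close>)
    fix a assume a: "a \<in> carrier A"
    fix b assume b: "b \<in> carrier A"
    show "(a \<oplus>\<^bsub>A\<^esub> b) \<odot>\<^bsub>?F\<^esub> u = a \<odot>\<^bsub>?F\<^esub> u \<oplus>\<^bsub>?F\<^esub> b \<odot>\<^bsub>?F\<^esub> u"
      using carr[OF u] a b by (auto simp: free_module_simps A.l_distr)
    show "(a \<otimes>\<^bsub>A\<^esub> b) \<odot>\<^bsub>?F\<^esub> u = a \<odot>\<^bsub>?F\<^esub> (b \<odot>\<^bsub>?F\<^esub> u)"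
      using carr[OF u] a b by (auto simp: free_module_simps A.m_assoc)
  next
    fix a u v assume a: "a \<in> carrier A" and u: "u \<in> carrier ?F" and v: "v \<in> carrier ?F"
    show "a \<odot>\<^bsub>?F\<^esub> (u \<oplus>\<^bsub>?F\<^esub> v) = a \<odot>\<^bsub>?F\<^esub> u \<oplus>\<^bsub>?F\<^esub> a \<odot>\<^bsub>?F\<^esub> v"
      using carr[OF u] carr[OF v] a by (auto simp: free_module_simps A.r_distr)
  qed auto
qed

lemma free_gen_closed:
  assumes "cring A"
  shows "free_gen A I i \<in> carrier (free_module A I)"
proof -
  interpret A: cring A by fact
  have "finite {j \<in> I. free_gen A I i j \<noteq> \<zero>\<^bsub>A\<^esub>}"
    by (rule finite_subset[of _ "{i}"]) (auto simp: free_gen_def)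
  then show ?thesis by (auto simp: free_module_simps free_gen_def)
qed

text \<open>By induction on a finite set containing the support of \<open>u\<close>: splitting off the value at one index
  writes \<open>u\<close> as a multiple of a generator plus an element with smaller support.\<close>

lemma free_module_generated:
  assumes "cring A" "submodule N A (free_module A I)"
    and gen: "\<And>i. i \<in> I \<Longrightarrow> free_gen A I i \<in> N"
    and u: "u \<in> carrier (free_module A I)"
  shows "u \<in> N"
proof -
  interpret A: cring A by fact
  let ?F = "free_module A I"
  interpret F: module A ?F by (rule module_free_module[OF assms(1)])
  have "u \<in> N" if "finite S" "u \<in> I \<rightarrow>\<^sub>E carrier A" "{i \<in> I. u i \<noteq> \<zero>\<^bsub>A\<^esub>} \<subseteq> S" for S u
    using that
  proof (induction S arbitrary: u rule: finite_induct)
    case empty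
    then have "u = \<zero>\<^bsub>?F\<^esub>"
      by (intro extensionalityI[of _ I]) (auto simp: free_module_simps PiE_iff)
    then show ?case using subgroup.one_closed[OF submodule.axioms(1)[OF assms(2)]] by simp
  next
    case (insert s S)
    show ?case
    proof (cases "s \<in> I")
      case False
      then show ?thesis using insert by blast
    next
      case True
      let ?u = "\<lambda>i\<in>I. if i = s then \<zero>\<^bsub>A\<^esub> else u i"
      have "?u \<in> N" using insert.prems by (intro insert.IH) auto
      moreover have "u s \<odot>\<^bsub>?F\<^esub> free_gen A I s \<in> N"
        using True insert.prems by (intro F.submoduleE(4)[OF assms(2)] gen) auto
      ultimately have "?u \<oplus>\<^bsub>?F\<^esub> u s \<odot>\<^bsub>?F\<^esub> free_gen A I s \<in> N"
        by (rule F.submoduleE(5)[OF assms(2)])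
      moreover have "?u \<oplus>\<^bsub>?F\<^esub> u s \<odot>\<^bsub>?F\<^esub> free_gen A I s = u"
      proof (rule extensionalityI[of _ I])
        fix i assume "i \<in> I"
        with True show "(?u \<oplus>\<^bsub>?F\<^esub> u s \<odot>\<^bsub>?F\<^esub> free_gen A I s) i = u i"
          using PiE_mem[OF insert.prems(1)] by (auto simp: free_module_simps free_gen_def)
      qed (use insert.prems(1) in \<open>auto simp: free_module_simps PiE_iff\<close>)
      ultimately show ?thesis by simp
    qed
  qed
  then show ?thesis using u by (auto simp: free_module_simps)
qed

text \<open>The universal property of the free module, in its existence half. The value at \<open>u\<close> has to be the
  sum of the \<open>u i \<odot> g i\<close> over the support of \<open>u\<close>.\<close>

lemma free_module_lift:
  assumes "cring A" "module A N" "g \<in> I \<rightarrow> carrier N"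
  obtains h where "h \<in> linear_maps A (free_module A I) N"
    and "\<And>i. i \<in> I \<Longrightarrow> h (free_gen A I i) = g i"
proof -
  interpret A: cring A by fact
  interpret N: module A N by fact
  let ?F = "free_module A I"
  interpret F: module A ?F by (rule module_free_module[OF assms(1)])
  let ?supp = "\<lambda>u. {i \<in> I. u i \<noteq> \<zero>\<^bsub>A\<^esub>}"
  define h where "h = (\<lambda>u\<in>carrier ?F. \<Oplus>\<^bsub>N\<^esub>i\<in>?supp u. u i \<odot>\<^bsub>N\<^esub> g i)"
  have g: "g i \<in> carrier N" if "i \<in> I" for i using that assms(3) by auto
  have carr: "u i \<in> carrier A" if "u \<in> carrier ?F" "i \<in> I" for u i
    using that by (auto simp: free_module_simps)
  have fin: "finite (?supp u)" if "u \<in> carrier ?F" for u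
    using that by (auto simp: free_module_simps)
  \<comment> \<open>Supports vary with \<open>u\<close>; linearity is checked on a common finite index set, which may be larger.\<close>
  have h: "h u = (\<Oplus>\<^bsub>N\<^esub>i\<in>S. u i \<odot>\<^bsub>N\<^esub> g i)"
    if "u \<in> carrier ?F" "finite S" "?supp u \<subseteq> S" "S \<subseteq> I" for u S
  proof -
    have "(\<Oplus>\<^bsub>N\<^esub>i\<in>?supp u. u i \<odot>\<^bsub>N\<^esub> g i) = (\<Oplus>\<^bsub>N\<^esub>i\<in>S. u i \<odot>\<^bsub>N\<^esub> g i)"
      by (rule N.add.finprod_mono_neutral_cong_left) (use that g carr[OF that(1)] in auto)
    then show ?thesis using that(1) by (simp add: h_def)
  qed
  have terms: "(\<lambda>i. u i \<odot>\<^bsub>N\<^esub> g i) \<in> S \<rightarrow> carrier N" if "u \<in> carrier ?F" "S \<subseteq> I" for u S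
    using that g carr[OF that(1)] by auto
  have "h \<in> linear_maps A ?F N"
  proof (rule linear_mapsI)
    show "h \<in> carrier ?F \<rightarrow>\<^sub>E carrier N"
    proof (rule PiE_I)
      fix u assume "u \<in> carrier ?F"
      then show "h u \<in> carrier N" 
        unfolding h_def by (auto intro!: N.finsum_closed g carr)
    qed (simp add: h_def)
  next
    fix u v assume u: "u \<in> carrier ?F" and v: "v \<in> carrier ?F"
    let ?S = "?supp u \<union> ?supp v"
    have S: "finite ?S" "?S \<subseteq> I" using fin u v by auto
    have "h (u \<oplus>\<^bsub>?F\<^esub> v) = (\<Oplus>\<^bsub>N\<^esub>i\<in>?S. (u \<oplus>\<^bsub>?F\<^esub> v) i \<odot>\<^bsub>N\<^esub> g i)"
    proof (rule h)
      show "u \<oplus>\<^bsub>?F\<^esub> v \<in> carrier ?F" using u v by simp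
      show "?supp (u \<oplus>\<^bsub>?F\<^esub> v) \<subseteq> ?S" by (auto simp: free_module_simps)
    qed (use S in auto)
    also have "\<dots> = (\<Oplus>\<^bsub>N\<^esub>i\<in>?S. u i \<odot>\<^bsub>N\<^esub> g i \<oplus>\<^bsub>N\<^esub> v i \<odot>\<^bsub>N\<^esub> g i)"
      by (rule N.finsum_cong')
        (use carr[OF u] carr[OF v] g in \<open>auto simp: free_module_simps N.smult_l_distr\<close>)
    also have "\<dots> = (\<Oplus>\<^bsub>N\<^esub>i\<in>?S. u i \<odot>\<^bsub>N\<^esub> g i) \<oplus>\<^bsub>N\<^esub> (\<Oplus>\<^bsub>N\<^esub>i\<in>?S. v i \<odot>\<^bsub>N\<^esub> g i)"
      by (rule N.finsum_addf) (use terms u v S in auto)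
    also have "\<dots> = h u \<oplus>\<^bsub>N\<^esub> h v" using h[OF u S(1)] h[OF v S(1)] S(2) by simp
    finally show "h (u \<oplus>\<^bsub>?F\<^esub> v) = h u \<oplus>\<^bsub>N\<^esub> h v" .
  next
    fix a u assume a: "a \<in> carrier A" and u: "u \<in> carrier ?F"
    let ?S = "?supp u"
    have "h (a \<odot>\<^bsub>?F\<^esub> u) = (\<Oplus>\<^bsub>N\<^esub>i\<in>?S. (a \<odot>\<^bsub>?F\<^esub> u) i \<odot>\<^bsub>N\<^esub> g i)"
    proof (rule h)
      show "a \<odot>\<^bsub>?F\<^esub> u \<in> carrier ?F" using a u by simp
      show "?supp (a \<odot>\<^bsub>?F\<^esub> u) \<subseteq> ?S" using a by (auto simp: free_module_simps)
    qed (use fin u in auto)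
    also have "\<dots> = (\<Oplus>\<^bsub>N\<^esub>i\<in>?S. a \<odot>\<^bsub>N\<^esub> (u i \<odot>\<^bsub>N\<^esub> g i))"
      by (rule N.finsum_cong') (use carr[OF u] g a in \<open>auto simp: free_module_simps N.smult_assoc1\<close>)
    also have "\<dots> = a \<odot>\<^bsub>N\<^esub> (\<Oplus>\<^bsub>N\<^esub>i\<in>?S. u i \<odot>\<^bsub>N\<^esub> g i)"
      by (rule N.finsum_smult_ldistr[symmetric]) (use a u fin terms in auto)
    also have "\<dots> = a \<odot>\<^bsub>N\<^esub> h u" using u by (simp add: h_def)
    finally show "h (a \<odot>\<^bsub>?F\<^esub> u) = a \<odot>\<^bsub>N\<^esub> h u" .
  qed
  moreover have "h (free_gen A I i) = g i" if i: "i \<in> I" for i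
  proof -
    have "h (free_gen A I i) = (\<Oplus>\<^bsub>N\<^esub>j\<in>{i}. free_gen A I i j \<odot>\<^bsub>N\<^esub> g j)"
      by (rule h[OF free_gen_closed[OF assms(1)]]) (use i in \<open>auto simp: free_gen_def\<close>)
    then show ?thesis using i g by (simp add: free_gen_def)
  qed
  ultimately show ?thesis by (rule that)
qed

section \<open>The module of differentials\<close>

lemma kaehler_rels_closed:
  assumes "algebra R A"
  shows "kaehler_rels R A \<subseteq> carrier (free_module A (carrier A))"
proof -
  interpret A: algebra R A by fact
  interpret F: module A "free_module A (carrier A)"
    by (rule module_free_module[OF A.M_cring])
  show ?thesis
    by (auto simp: kaehler_rels_def Let_def free_gen_closed[OF A.M_cring])
qed

lemma submodule_kaehler_submodule:
  assumes "algebra R A"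
  shows "submodule (kaehler_submodule R A) A (free_module A (carrier A))"
  unfolding kaehler_submodule_def
  by (intro submodule_submodule_span module_free_module kaehler_rels_closed assms
      algebra.M_cring[OF assms])

lemma module_kaehler:
  assumes "algebra R A"
  shows "module A (kaehler R A)"
  unfolding kaehler_def
  by (intro module_quot_module module_free_module submodule_kaehler_submodule assms
      algebra.M_cring[OF assms])

lemma univ_deriv_closed:
  assumes "algebra R A"
  shows "univ_deriv R A a \<in> carrier (kaehler R A)"
  unfolding univ_deriv_def kaehler_def quot_module_carrier
  by (intro imageI free_gen_closed algebra.M_cring[OF assms])

lemma kaehler_relI: "x \<in> kaehler_rels R A \<Longrightarrow> x \<in> kaehler_submodule R A"
  unfolding kaehler_submodule_def by (rule subsetD[OF submodule_span_superset])

text \<open>Additivity, the Leibniz rule and the vanishing on scalars are the three families of relations,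
  read in the quotient. Together they say that \<open>univ_deriv R A\<close> is an \<open>R\<close>-linear derivation.\<close>

lemma univ_deriv_add:
  assumes "algebra R A" "a \<in> carrier A" "b \<in> carrier A"
  shows "univ_deriv R A (a \<oplus>\<^bsub>A\<^esub> b) =
    univ_deriv R A a \<oplus>\<^bsub>kaehler R A\<^esub> univ_deriv R A b"
proof -
  interpret A: algebra R A by fact
  let ?F = "free_module A (carrier A)" and ?d = "free_gen A (carrier A)" and ?N = "kaehler_submodule R A"
  have F: "module A ?F" by (rule module_free_module[OF A.M_cring])
  interpret F: module A ?F by (rule F)
  note N = submodule_kaehler_submodule[OF assms(1)] and d = free_gen_closed[OF A.M_cring]
  have "?d (a \<oplus>\<^bsub>A\<^esub> b) \<ominus>\<^bsub>?F\<^esub> (?d a \<oplus>\<^bsub>?F\<^esub> ?d b) \<in> ?N"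
    by (rule kaehler_relI) (use assms(2,3) in \<open>auto simp: kaehler_rels_def Let_def\<close>)
  then have "?N +>\<^bsub>?F\<^esub> ?d (a \<oplus>\<^bsub>A\<^esub> b) = ?N +>\<^bsub>?F\<^esub> (?d a \<oplus>\<^bsub>?F\<^esub> ?d b)"
    by (subst coset_eq_iff[OF F N]) (auto simp: d)
  then show ?thesis
    by (simp add: univ_deriv_def kaehler_def quot_module_add[OF F N] d)
qed

lemma univ_deriv_mult:
  assumes "algebra R A" "a \<in> carrier A" "b \<in> carrier A"
  shows "univ_deriv R A (a \<otimes>\<^bsub>A\<^esub> b) =
    a \<odot>\<^bsub>kaehler R A\<^esub> univ_deriv R A b \<oplus>\<^bsub>kaehler R A\<^esub> b \<odot>\<^bsub>kaehler R A\<^esub> univ_deriv R A a"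
proof -
  interpret A: algebra R A by fact
  let ?F = "free_module A (carrier A)" and ?d = "free_gen A (carrier A)" and ?N = "kaehler_submodule R A"
  have F: "module A ?F" by (rule module_free_module[OF A.M_cring])
  interpret F: module A ?F by (rule F)
  note N = submodule_kaehler_submodule[OF assms(1)] and d = free_gen_closed[OF A.M_cring]
  have "?d (a \<otimes>\<^bsub>A\<^esub> b) \<ominus>\<^bsub>?F\<^esub> (a \<odot>\<^bsub>?F\<^esub> ?d b \<oplus>\<^bsub>?F\<^esub> b \<odot>\<^bsub>?F\<^esub> ?d a) \<in> ?N"
    by (rule kaehler_relI) (use assms(2,3) in \<open>auto simp: kaehler_rels_def Let_def\<close>)
  then have "?N +>\<^bsub>?F\<^esub> ?d (a \<otimes>\<^bsub>A\<^esub> b) = ?N +>\<^bsub>?F\<^esub> (a \<odot>\<^bsub>?F\<^esub> ?d b \<oplus>\<^bsub>?F\<^esub> b \<odot>\<^bsub>?F\<^esub> ?d a)"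
    by (subst coset_eq_iff[OF F N]) (auto simp: d assms(2,3))
  then show ?thesis
    by (simp add: univ_deriv_def kaehler_def quot_module_add[OF F N] quot_module_smult[OF F N]
        d assms(2,3))
qed

lemma univ_deriv_scalar:
  assumes "algebra R A" "r \<in> carrier R"
  shows "univ_deriv R A (r \<odot>\<^bsub>A\<^esub> \<one>\<^bsub>A\<^esub>) = \<zero>\<^bsub>kaehler R A\<^esub>"
proof -
  interpret A: algebra R A by fact
  let ?F = "free_module A (carrier A)" and ?d = "free_gen A (carrier A)" and ?N = "kaehler_submodule R A"
  have F: "module A ?F" by (rule module_free_module[OF A.M_cring])
  have N: "abelian_subgroup ?N ?F"
    by (rule submodule_abelian_subgroup[OF F submodule_kaehler_submodule[OF assms(1)]])
  have "?d (r \<odot>\<^bsub>A\<^esub> \<one>\<^bsub>A\<^esub>) \<in> ?N"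
    by (rule kaehler_relI) (use assms(2) in \<open>auto simp: kaehler_rels_def Let_def\<close>)
  then show ?thesis
    by (simp add: univ_deriv_def kaehler_def quot_module_def abelian_subgroup.a_rcos_const[OF N])
qed

text \<open>Pulled back to the free module, both maps agree on the generators, hence everywhere; and every
  differential is the class of an element of the free module.\<close>

lemma kaehler_hom_eqI:
  assumes "algebra R A" "module A N"
    and h: "h \<in> linear_maps A (kaehler R A) N" and k: "k \<in> linear_maps A (kaehler R A) N"
    and eq: "\<And>a. a \<in> carrier A \<Longrightarrow> h (univ_deriv R A a) = k (univ_deriv R A a)"
  shows "h = k"
proof (rule linear_map_ext[OF h k])
  interpret A: algebra R A by fact
  let ?F = "free_module A (carrier A)" and ?N = "kaehler_submodule R A"
  have F: "module A ?F" by (rule module_free_module[OF A.M_cring])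
  interpret F: module A ?F by (rule F)
  let ?p = "\<lambda>x\<in>carrier ?F. ?N +>\<^bsub>?F\<^esub> x"
  have p: "?p \<in> linear_maps A ?F (kaehler R A)"
    unfolding kaehler_def by (rule quot_module_proj_linear[OF F submodule_kaehler_submodule[OF assms(1)]])
  let ?E = "{x \<in> carrier ?F. compose (carrier ?F) h ?p x = compose (carrier ?F) k ?p x}"
  have E: "submodule ?E A ?F"
    by (intro submodule_equalizer[OF F assms(2)] linear_map_compose[OF p h] linear_map_compose[OF p k])
      auto
  have gen: "free_gen A (carrier A) a \<in> ?E" if "a \<in> carrier A" for a
    using eq[OF that] free_gen_closed[OF A.M_cring, of "carrier A" a]
    by (simp add: compose_def univ_deriv_def)
  fix X assume "X \<in> carrier (kaehler R A)"
  then obtain x where x: "x \<in> carrier ?F" "X = ?N +>\<^bsub>?F\<^esub> x"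
    by (auto simp: kaehler_def quot_module_carrier)
  have "x \<in> ?E" by (rule free_module_generated[OF A.M_cring E gen x(1)])
  with x show "h X = k X" by (simp add: compose_def)
qed

text \<open>Every \<open>R\<close>-derivation \<open>D\<close> into an \<open>A\<close>-module factors through the universal one. The values of \<open>D\<close>
  extend to a linear map on the free module. Its kernel is a submodule, and the laws of a derivation
  say that it contains the generating relations, so it contains all that they span and the map
  descends to the quotient.\<close>

lemma kaehler_lift:
  assumes "algebra R A" "module A N"
    and closed: "D \<in> carrier A \<rightarrow> carrier N"
    and add: "\<And>a b. \<lbrakk>a \<in> carrier A; b \<in> carrier A\<rbrakk> \<Longrightarrow> D (a \<oplus>\<^bsub>A\<^esub> b) = D a \<oplus>\<^bsub>N\<^esub> D b"
    and mult: "\<And>a b. \<lbrakk>a \<in> carrier A; b \<in> carrier A\<rbrakk> \<Longrightarrow>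
      D (a \<otimes>\<^bsub>A\<^esub> b) = a \<odot>\<^bsub>N\<^esub> D b \<oplus>\<^bsub>N\<^esub> b \<odot>\<^bsub>N\<^esub> D a"
    and scalar: "\<And>r. r \<in> carrier R \<Longrightarrow> D (r \<odot>\<^bsub>A\<^esub> \<one>\<^bsub>A\<^esub>) = \<zero>\<^bsub>N\<^esub>"
  obtains h where "h \<in> linear_maps A (kaehler R A) N"
    and "\<And>a. a \<in> carrier A \<Longrightarrow> h (univ_deriv R A a) = D a"
proof -
  interpret A: algebra R A by fact
  interpret N: module A N by fact
  let ?F = "free_module A (carrier A)" and ?d = "free_gen A (carrier A)" and ?N = "kaehler_submodule R A"
  have F: "module A ?F" by (rule module_free_module[OF A.M_cring])
  interpret F: module A ?F by (rule F)
  note d = free_gen_closed[OF A.M_cring]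
  obtain g where g: "g \<in> linear_maps A ?F N" and gd: "\<And>a. a \<in> carrier A \<Longrightarrow> g (?d a) = D a"
    using free_module_lift[OF A.M_cring assms(2) closed] by blast
  note lin = linear_mapsD[OF g] and minus = linear_map_minus[OF F assms(2) g]
  have D: "D a \<in> carrier N" if "a \<in> carrier A" for a using closed that by auto
  let ?K = "{x \<in> carrier ?F. g x = \<zero>\<^bsub>N\<^esub>}"
  have "x \<in> ?K" if "x \<in> kaehler_rels R A" for x
  proof -
    have x: "x \<in> carrier ?F" using kaehler_rels_closed[OF assms(1)] that by blast
    from that consider
        (add) a b where "a \<in> carrier A" "b \<in> carrier A" "x = ?d (a \<oplus>\<^bsub>A\<^esub> b) \<ominus>\<^bsub>?F\<^esub> (?d a \<oplus>\<^bsub>?F\<^esub> ?d b)"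
      | (mult) a b where "a \<in> carrier A" "b \<in> carrier A"
          "x = ?d (a \<otimes>\<^bsub>A\<^esub> b) \<ominus>\<^bsub>?F\<^esub> (a \<odot>\<^bsub>?F\<^esub> ?d b \<oplus>\<^bsub>?F\<^esub> b \<odot>\<^bsub>?F\<^esub> ?d a)"
      | (scalar) r where "r \<in> carrier R" "x = ?d (r \<odot>\<^bsub>A\<^esub> \<one>\<^bsub>A\<^esub>)"
      by (auto simp: kaehler_rels_def Let_def)
    then have "g x = \<zero>\<^bsub>N\<^esub>"
    proof cases
      case add
      have "g x = D (a \<oplus>\<^bsub>A\<^esub> b) \<ominus>\<^bsub>N\<^esub> (D a \<oplus>\<^bsub>N\<^esub> D b)"
        by (simp add: add d minus lin gd)
      then show ?thesis by (simp add: add assms(4) D a_minus_def N.r_neg)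
    next
      case mult
      have "g x = D (a \<otimes>\<^bsub>A\<^esub> b) \<ominus>\<^bsub>N\<^esub> (a \<odot>\<^bsub>N\<^esub> D b \<oplus>\<^bsub>N\<^esub> b \<odot>\<^bsub>N\<^esub> D a)"
        by (simp add: mult d minus lin gd)
      then show ?thesis by (simp add: mult assms(5) D a_minus_def N.r_neg)
    next
      case scalar
      then show ?thesis by (simp add: gd assms(6))
    qed
    with x show ?thesis by simp
  qed
  then have "?N \<subseteq> ?K"
    unfolding kaehler_submodule_def
    by (intro submodule_span_least submodule_kernel[OF F assms(2) g] subsetI)
  then have "g x = \<zero>\<^bsub>N\<^esub>" if "x \<in> ?N" for x using that by blast
  then obtain h where h: "h \<in> linear_maps A (kaehler R A) N"
      and hg: "\<And>x. x \<in> carrier ?F \<Longrightarrow> h (?N +>\<^bsub>?F\<^esub> x) = g x"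
    using quot_module_lift[OF F submodule_kaehler_submodule[OF assms(1)] assms(2) g]
    unfolding kaehler_def by blast
  show ?thesis
    by (rule that[OF h]) (simp add: univ_deriv_def hg d gd)
qed

text \<open>The map of differentials exists because \<open>a \<mapsto> d (f a)\<close> is an \<open>R\<close>-derivation of \<open>A\<close> with values in the
  restriction of scalars of the differentials of \<open>B\<close>. That \<open>f\<close> is multiplicative gives the Leibniz
  rule; that it is \<open>R\<close>-linear and preserves the unit makes constants go to constants.\<close>

lemma is_kaehler_map_ex1:
  assumes "algebra R A" "algebra R B" "f \<in> ring_hom A B" "f \<in> linear_maps R A B"
  shows "\<exists>!\<rho>. is_kaehler_map R A B f \<rho>"
proof -
  interpret A: algebra R A by fact
  interpret B: algebra R B by fact
  let ?N = "res_scalars f (kaehler R B)"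
  have N: "module A ?N"
    by (rule module_res_scalars[OF A.M_cring module_kaehler[OF assms(2)] assms(3)])
  have N_simps: "carrier ?N = carrier (kaehler R B)" "\<zero>\<^bsub>?N\<^esub> = \<zero>\<^bsub>kaehler R B\<^esub>"
    "add ?N = add (kaehler R B)" "a \<odot>\<^bsub>?N\<^esub> x = f a \<odot>\<^bsub>kaehler R B\<^esub> x" for a x
    by (simp_all add: res_scalars_def)
  note f = ring_hom_closed[OF assms(3)] ring_hom_add[OF assms(3)] ring_hom_mult[OF assms(3)]
    ring_hom_one[OF assms(3)] linear_mapsD(4)[OF assms(4)]
  obtain h where "h \<in> linear_maps A (kaehler R A) ?N"
    and "\<And>a. a \<in> carrier A \<Longrightarrow> h (univ_deriv R A a) = univ_deriv R B (f a)"
    by (rule kaehler_lift[OF assms(1) N, of "\<lambda>a. univ_deriv R B (f a)"])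
      (auto simp: N_simps f univ_deriv_closed[OF assms(2)] univ_deriv_add[OF assms(2)]
        univ_deriv_mult[OF assms(2)] univ_deriv_scalar[OF assms(2)])
  then show ?thesis
    using kaehler_hom_eqI[OF assms(1) N] unfolding is_kaehler_map_def by (intro ex1I[of _ h]) auto
qed

lemma is_kaehler_map_kaehler_map:
  assumes "algebra R A" "algebra R B" "f \<in> ring_hom A B" "f \<in> linear_maps R A B"
  shows "is_kaehler_map R A B f (kaehler_map R A B f)"
  unfolding kaehler_map_def by (rule theI'[OF is_kaehler_map_ex1[OF assms]])

lemma kaehler_map_eqI:
  assumes "algebra R A" "algebra R B" "f \<in> ring_hom A B" "f \<in> linear_maps R A B"
    and "is_kaehler_map R A B f \<rho>"
  shows "kaehler_map R A B f = \<rho>"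
  unfolding kaehler_map_def by (rule the1_equality, rule is_kaehler_map_ex1[OF assms(1-4)], rule assms(5))


section \<open>The two categories\<close>

lemma ring_hom_restrict_id:
  assumes "ring A"
  shows "(\<lambda>x\<in>carrier A. x) \<in> ring_hom A A"
proof -
  interpret A: ring A by fact
  show ?thesis by (rule ring_hom_memI) auto
qed

lemma ring_hom_compose:
  assumes "ring A" "f \<in> ring_hom A B" "g \<in> ring_hom B C"
  shows "compose (carrier A) g f \<in> ring_hom A C"
proof -
  interpret A: ring A by fact
  show ?thesis
    using ring_hom_closed[OF assms(2)] ring_hom_closed[OF assms(3)]
      ring_hom_add[OF assms(2)] ring_hom_add[OF assms(3)]
      ring_hom_mult[OF assms(2)] ring_hom_mult[OF assms(3)]
      ring_hom_one[OF assms(2)] ring_hom_one[OF assms(3)]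
    by (intro ring_hom_memI) (auto simp: compose_def)
qed

lemma linear_map_restrict_id:
  assumes "module R M"
  shows "(\<lambda>x\<in>carrier M. x) \<in> linear_maps R M M"
proof -
  interpret M: module R M by fact
  show ?thesis by (rule linear_mapsI) auto
qed

lemma category_CAlg:
  fixes R :: "('r, 'x) ring_scheme"
  shows "category (CAlg R :: (('r, 'a) module, 'a \<Rightarrow> 'a) category)"
    (is "category ?C")
proof (rule category.intro)
  show "Id ?C A \<in> Hom ?C A A" if "A \<in> Ob ?C" for A :: "('r, 'a) module"
  proof -
    interpret algebra R A using that by (simp add: CAlg_def)
    show ?thesis
      by (simp add: CAlg_def ring_hom_restrict_id[OF cring.axioms(1)[OF M_cring]] linear_map_restrict_id[OF module])
  qed
next
  fix A B C :: "('r, 'a) module" and f g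
  assume A: "A \<in> Ob ?C" and f: "f \<in> Hom ?C A B" and g: "g \<in> Hom ?C B C"
  interpret algebra R A using A by (simp add: CAlg_def)
  have "compose (carrier A) g f \<in> linear_maps R A C"
    by (rule linear_map_compose[of _ _ _ B]) (use f g in \<open>auto simp: CAlg_def\<close>)
  then show "Comp ?C A B C g f \<in> Hom ?C A C"
    using f g by (auto simp: CAlg_def intro: ring_hom_compose[OF cring.axioms(1)[OF M_cring]])
next
  fix A B :: "('r, 'a) module" and f
  assume "f \<in> Hom ?C A B"
  then have f: "f \<in> carrier A \<rightarrow>\<^sub>E carrier B" by (auto simp: CAlg_def linear_maps_def)
  show "Comp ?C A B B (Id ?C B) f = f"
    using f by (auto simp: CAlg_def PiE_def intro: Id_compose)
  show "Comp ?C A A B f (Id ?C A) = f"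
    using f by (auto simp: CAlg_def PiE_def intro: compose_Id)
next
  fix W X Y Z :: "('r, 'a) module" and f g h
  assume "f \<in> Hom ?C W X"
  then have f: "f \<in> carrier W \<rightarrow> carrier X" by (auto simp: CAlg_def linear_maps_def)
  show "Comp ?C W Y Z h (Comp ?C W X Y g f) =
      Comp ?C W X Z (Comp ?C X Y Z h g) f"
    using compose_assoc[OF f] by (simp add: CAlg_def)
qed

lemma ModCat_Hom:
  "(f, \<rho>) \<in> Hom ModCat (R, M) (S, N) \<longleftrightarrow> f \<in> ring_hom R S \<and> f \<in> extensional (carrier R) \<and>
    \<rho> \<in> linear_maps R M (res_scalars f N)"
  by (simp add: ModCat_def)

text \<open>The second component of a composite in the category of modules: restricting \<open>\<phi>\<close> along \<open>f\<close> and
  then composing lands in the restriction of scalars along the composite ring map.\<close>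

lemma linear_maps_res_scalars_compose:
  assumes "module R M" "f \<in> carrier R \<rightarrow> carrier S"
    and "\<rho> \<in> linear_maps R M (res_scalars f N)" "\<phi> \<in> linear_maps S N (res_scalars g P)"
  shows "compose (carrier M) \<phi> \<rho> \<in> linear_maps R M (res_scalars (compose (carrier R) g f) P)"
proof -
  interpret M: module R M by fact
  show ?thesis
    using linear_mapsD[OF assms(3)] linear_mapsD[OF assms(4)] assms(2)
    by (intro linear_mapsI) (auto simp: compose_def res_scalars_def Pi_def)
qed

lemma linear_maps_res_scalars_id:
  assumes "module R M"
  shows "(\<lambda>x\<in>carrier M. x) \<in> linear_maps R M (res_scalars (\<lambda>x\<in>carrier R. x) M)"
proof -
  interpret M: module R M by fact
  show ?thesis by (rule linear_mapsI) (auto simp: res_scalars_def)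
qed

lemma category_ModCat: "category ModCat"
proof (rule category.intro)
  show "Id ModCat X \<in> Hom ModCat X X" if "X \<in> Ob ModCat" for X :: "'a ring \<times> ('a, 'b) module"
    using that
    by (auto simp: ModCat_def linear_maps_res_scalars_id intro: ring_hom_restrict_id cring.axioms)
next
  fix X Y Z :: "'a ring \<times> ('a, 'b) module" and u v
  assume X: "X \<in> Ob ModCat" and u: "u \<in> Hom ModCat X Y" and v: "v \<in> Hom ModCat Y Z"
  obtain R M S N T P where eqs: "X = (R, M)" "Y = (S, N)" "Z = (T, P)" by (meson surj_pair)
  obtain f \<rho> g \<phi> where uv: "u = (f, \<rho>)" "v = (g, \<phi>)" by (meson surj_pair)
  have R: "cring R" "module R M" using X by (auto simp: eqs ModCat_def)
  have f: "f \<in> ring_hom R S" "\<rho> \<in> linear_maps R M (res_scalars f N)"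
    and g: "g \<in> ring_hom S T" "\<phi> \<in> linear_maps S N (res_scalars g P)"
    using u v by (auto simp: eqs uv ModCat_Hom)
  have fc: "f \<in> carrier R \<rightarrow> carrier S" using ring_hom_closed[OF f(1)] by auto
  have "(compose (carrier R) g f, compose (carrier M) \<phi> \<rho>) \<in> Hom ModCat (R, M) (T, P)"
    using ring_hom_compose[OF cring.axioms(1)[OF R(1)] f(1) g(1)]
      linear_maps_res_scalars_compose[OF R(2) fc f(2) g(2)]
    by (simp add: ModCat_Hom compose_def)
  then show "Comp ModCat X Y Z v u \<in> Hom ModCat X Z"
    by (simp add: eqs uv ModCat_def)
next
  fix X Y :: "'a ring \<times> ('a, 'b) module" and u
  assume u: "u \<in> Hom ModCat X Y"
  obtain R M S N f \<rho> where eqs: "X = (R, M)" "Y = (S, N)" "u = (f, \<rho>)" by (meson surj_pair)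
  have f: "f \<in> carrier R \<rightarrow> carrier S" "f \<in> extensional (carrier R)"
    and \<rho>: "\<rho> \<in> carrier M \<rightarrow> carrier N" "\<rho> \<in> extensional (carrier M)"
    using u ring_hom_closed[of f R S] by (auto simp: eqs ModCat_Hom linear_maps_def res_scalars_def PiE_iff)
  show "Comp ModCat X Y Y (Id ModCat Y) u = u" "Comp ModCat X X Y u (Id ModCat X) = u"
    using Id_compose[OF f] Id_compose[OF \<rho>] compose_Id[OF f] compose_Id[OF \<rho>]
    by (simp_all add: eqs ModCat_def)
next
  fix W X Y Z :: "'a ring \<times> ('a, 'b) module" and u v w :: "('a \<Rightarrow> 'a) \<times> ('b \<Rightarrow> 'b)"
  assume u: "u \<in> Hom ModCat W X"
  obtain R M S N T P U Q where eqs: "W = (R, M)" "X = (S, N)" "Y = (T, P)" "Z = (U, Q)"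
    by (meson surj_pair)
  obtain f \<rho> g \<phi> h \<psi> where uvw: "u = (f, \<rho>)" "v = (g, \<phi>)" "w = (h, \<psi>)" by (meson surj_pair)
  have f: "f \<in> carrier R \<rightarrow> carrier S" and \<rho>: "\<rho> \<in> carrier M \<rightarrow> carrier N"
    using u ring_hom_closed[of f R S] by (auto simp: eqs uvw ModCat_Hom linear_maps_def res_scalars_def PiE_iff)
  show "Comp ModCat W Y Z w (Comp ModCat W X Y v u) =
      Comp ModCat W X Z (Comp ModCat X Y Z w v) u"
    using compose_assoc[OF f, of h g] compose_assoc[OF \<rho>, of \<psi> \<phi>] by (simp add: eqs uvw ModCat_def)
qed


section \<open>Functoriality\<close>

text \<open>As a map of differentials is determined by its defining property, compatibility with identities
  and composition only asks that identity maps and composites have this property. Both are computed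
  on the elements \<open>univ_deriv R A a\<close>.\<close>

lemma is_kaehler_map_id:
  assumes "algebra R A"
  shows "is_kaehler_map R A A (\<lambda>x\<in>carrier A. x) (\<lambda>x\<in>carrier (kaehler R A). x)"
  using linear_maps_res_scalars_id[OF module_kaehler[OF assms]] univ_deriv_closed[OF assms]
  by (simp add: is_kaehler_map_def)

lemma is_kaehler_map_compose:
  assumes "algebra R A" "f \<in> carrier A \<rightarrow> carrier B"
    and "is_kaehler_map R A B f \<rho>" "is_kaehler_map R B C g \<phi>"
  shows "is_kaehler_map R A C (compose (carrier A) g f) (compose (carrier (kaehler R A)) \<phi> \<rho>)"
  using assms linear_maps_res_scalars_compose[OF module_kaehler[OF assms(1)] assms(2)]
    univ_deriv_closed[OF assms(1)]
  by (auto simp: is_kaehler_map_def compose_def)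

text \<open>Objects of the category of modules carry a plain ring, so the functor forgets the scalar
  multiplication of an algebra. The ring structure, the modules over it and the maps out of it stay
  the same.\<close>

lemma cring_truncate:
  assumes "cring A"
  shows "cring (ring.truncate A)"
proof -
  interpret A: cring A by fact
  have "abelian_group (ring.truncate A)"
    using A.l_neg by (intro abelian_groupI)
      (auto simp: ring.truncate_def A.a_ac intro: bexI[OF _ A.a_inv_closed])
  then show ?thesis
    by (intro cringI comm_monoidI) (auto simp: ring.truncate_def A.m_ac A.l_distr A.r_distr)
qed

lemma module_truncate:
  assumes "module A N"
  shows "module (ring.truncate A) N"
proof -
  interpret N: module A N by fact
  show ?thesis
    by (intro moduleI cring_truncate N.is_cring N.abelian_group_axioms)
      (auto simp: ring.truncate_def N.smult_l_distr N.smult_r_distr N.smult_assoc1)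
qed

lemma truncate_simps:
  "carrier (ring.truncate A) = carrier A"
  "ring_hom (ring.truncate A) (ring.truncate B) = ring_hom A B"
  "linear_maps (ring.truncate A) M N = linear_maps A M N"
  by (simp_all add: ring.truncate_def ring_hom_def linear_maps_def)

theorem proposition9:
  fixes R :: "'r ring"
  assumes "cring R"
  shows "(\<forall>A \<in> Ob (CAlg R :: (('r, 'a) module, 'a \<Rightarrow> 'a) category).
      \<forall>B \<in> Ob (CAlg R). \<forall>f \<in> Hom (CAlg R) A B. \<exists>!\<rho>. is_kaehler_map R A B f \<rho>) \<and>
    cat_functor (CAlg R :: (('r, 'a) module, 'a \<Rightarrow> 'a) category) ModCat
      (\<lambda>A. (ring.truncate A, kaehler R A))
      (\<lambda>A B f. (f, kaehler_map R A B f))"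
proof (intro conjI ballI)
  fix A B :: "('r, 'a) module" and f
  assume "A \<in> Ob (CAlg R)" "B \<in> Ob (CAlg R)" "f \<in> Hom (CAlg R) A B"
  then show "\<exists>!\<rho>. is_kaehler_map R A B f \<rho>"
    by (intro is_kaehler_map_ex1) (auto simp: CAlg_def)
next
  let ?C = "CAlg R :: (('r, 'a) module, 'a \<Rightarrow> 'a) category"
  have alg: "algebra R A" if "A \<in> Ob ?C" for A
    using that by (simp add: CAlg_def)
  have hom: "f \<in> ring_hom A B" "f \<in> linear_maps R A B" if "f \<in> Hom ?C A B" for A B f
    using that by (auto simp: CAlg_def)
  have map: "is_kaehler_map R A B f (kaehler_map R A B f)"
    if "A \<in> Ob ?C" "B \<in> Ob ?C" "f \<in> Hom ?C A B" for A B f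
    by (intro is_kaehler_map_kaehler_map alg hom that)
  show "cat_functor ?C ModCat (\<lambda>A. (ring.truncate A, kaehler R A)) (\<lambda>A B f. (f, kaehler_map R A B f))"
  proof (intro cat_functor.intro category_CAlg category_ModCat cat_functor_axioms.intro)
    fix A assume A: "A \<in> Ob ?C"
    show "(ring.truncate A, kaehler R A) \<in> Ob ModCat"
      using cring_truncate[OF algebra.M_cring[OF alg[OF A]]]
        module_truncate[OF module_kaehler[OF alg[OF A]]]
      by (simp add: ModCat_def)
    \<comment> \<open>The identity of the differentials is a candidate, so it is the chosen map.\<close>
    have "Id ?C A \<in> Hom ?C A A" by (rule category.Id_in_Hom[OF category_CAlg A])
    from kaehler_map_eqI[OF alg[OF A] alg[OF A] hom[OF this]]
    show "(Id ?C A, kaehler_map R A A (Id ?C A)) = Id ModCat (ring.truncate A, kaehler R A)"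
      using is_kaehler_map_id[OF alg[OF A]] by (simp add: CAlg_def ModCat_def truncate_simps)
  next
    fix A B f assume *: "A \<in> Ob ?C" "B \<in> Ob ?C" "f \<in> Hom ?C A B"
    show "(f, kaehler_map R A B f) \<in>
        Hom ModCat (ring.truncate A, kaehler R A) (ring.truncate B, kaehler R B)"
      using map[OF *] hom[OF *(3)] linear_mapsD(1)[OF hom(2)[OF *(3)]]
      by (simp add: ModCat_Hom truncate_simps is_kaehler_map_def PiE_def)
  next
    fix A B C f g
    assume A: "A \<in> Ob ?C" and B: "B \<in> Ob ?C" and C: "C \<in> Ob ?C"
      and f: "f \<in> Hom ?C A B" and g: "g \<in> Hom ?C B C"
    have fc: "f \<in> carrier A \<rightarrow> carrier B" using ring_hom_closed[OF hom(1)[OF f]] by auto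
    \<comment> \<open>The composite of the chosen maps is a candidate, so it is the chosen map of the composite.\<close>
    have "Comp ?C A B C g f \<in> Hom ?C A C"
      by (rule category.Comp_in_Hom[OF category_CAlg A B C f g])
    from kaehler_map_eqI[OF alg[OF A] alg[OF C] hom[OF this]]
    show "(Comp ?C A B C g f, kaehler_map R A C (Comp ?C A B C g f)) =
        Comp ModCat (ring.truncate A, kaehler R A) (ring.truncate B, kaehler R B)
          (ring.truncate C, kaehler R C) (g, kaehler_map R B C g) (f, kaehler_map R A B f)"
      using is_kaehler_map_compose[OF alg[OF A] fc map[OF A B f] map[OF B C g]]
      by (simp add: CAlg_def ModCat_def truncate_simps)
  qed
qed

end
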